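(* Let $n\ge 1$ and let $A\in M_n(\mathbb{C})$ satisfy $A=A^*$. Then $\|A\|_{2,2}\le\|A\|_{p,p}\le\|A\|_{1,1}=\|A\|_{\infty,\infty}$ for every $p\in[1,\infty]$; the function $p\mapsto\|A\|_{p,p}$ is decreasing on $[1,2]$ and increasing on $[2,\infty]$; and $$\|A\|_{p,p}\le\begin{cases}\|A\|_{1,1}^{(2-p)/p}\,\|A\|_{2,2}^{2(p-1)/p}, & p\in(1,2),\\ \|A\|_{2,2}^{2/p}\,\|A\|_{\infty,\infty}^{(p-2)/p}, & p\in(2,\infty).\end{cases}$$
   Context: For $\xi=(x_1,\dots,x_n)\in\mathbb{C}^n$, $\|\xi\|_p=(\sum_{i=1}^n|x_i|^p)^{1/p}$ for $1\le p<\infty$ and $\|\xi\|_\infty=\max_i|x_i|$. For $A\in M_n(\mathbb{C})$, $\|A\|_{p,p}=\sup\{\|A\xi\|_p:\xi\in\mathbb{C}^n,\ \|\xi\|_p=1\}$, and $A^*$ is the conjugate transpose of $A$. "Decreasing" and "increasing" are meant in the non-strict sense. *)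

theory Defs
  imports "HOL-Analysis.Analysis"
begin

text \<open>Exponents are extended reals, so that \<^term>\<open>p = (\<infinity> :: ereal)\<close> is allowed; the definition is meant
  for \<^prop>\<open>(1 :: ereal) \<le> p\<close>. The library's \<^const>\<open>infnorm\<close> is not the case \<open>p = \<infinity>\<close>: on
  \<^typ>\<open>complex ^ 'n\<close> it takes the maximum over real and imaginary parts, not over moduli.\<close>

definition lp_norm :: "ereal \<Rightarrow> complex ^ 'n \<Rightarrow> real" where
  "lp_norm p x =
     (if p = \<infinity> then Max (range (\<lambda>i. cmod (x $ i)))
      else (\<Sum>i\<in>UNIV. cmod (x $ i) powr real_of_ereal p) powr (1 / real_of_ereal p))"

definition lp_opnorm :: "ereal \<Rightarrow> complex ^ 'n ^ 'n \<Rightarrow> real" where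
  "lp_opnorm p A = Sup {lp_norm p (A *v x) | x. lp_norm p x = 1}"

definition conj_transpose :: "complex ^ 'n ^ 'm \<Rightarrow> complex ^ 'm ^ 'n" where
  "conj_transpose A = (\<chi> i j. cnj (A $ j $ i))"

end

theory Submission
  imports Defs "HOL-Complex_Analysis.Conformal_Mappings"
begin

text \<open>Write \<open>t = 1 / p\<close>, with \<open>t = 0\<close> for \<open>p = \<infinity>\<close>, and let \<open>M t\<close> be the operator norm of \<open>A\<close> for the
  exponent \<open>p\<close>. Everything follows from two properties of \<open>M\<close> on \<open>[0, 1]\<close>.

  First, \<open>M\<close> is log-convex (\<open>Riesz_Thorin\<close>). Once the vectors are normalised, the entries of a unit vector
  for the parameter \<open>t\<close> are powers \<open>a\<^sub>i\<^sup>t\<close> of the entries of a probability vector, up to phases. The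
  same \<open>a\<close> gives unit vectors for every other parameter, so letting \<open>t\<close> become complex produces a
  holomorphic function of \<open>t\<close>, to which the Hadamard three lines theorem (\<open>three_lines\<close>) applies.

  Second, \<open>M (1 - t) = M t\<close> when \<open>A\<close> is Hermitian (\<open>Hermitian_recip_opnorm_sym\<close>): the pairing
  \<open>\<Sum>i. x\<^sub>i * y\<^sub>i\<close> makes the norms for \<open>t\<close> and \<open>1 - t\<close> dual to each other, by Holder's inequality
  (\<open>Holder_recip_norm\<close>) and the existence of vectors attaining equality in it (\<open>norming_vector\<close>), and
  taking the adjoint exchanges the two.

  A log-convex function symmetric about \<open>1/2\<close> is least at \<open>1/2\<close> and does not decrease as its argument moves away
  from there, which is \<open>Hermitian_recip_opnorm_mono\<close>; since \<open>p \<mapsto> 1 / p\<close> reverses the order, these are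
  the comparisons of the norms and their monotonicity in \<open>p\<close>. The two explicit bounds are log-convexity
  between the parameters \<open>1\<close>, \<open>1/2\<close> and between \<open>1/2\<close>, \<open>0\<close>.\<close>

section \<open>The three lines theorem\<close>

text \<open>The strip is unbounded, so the maximum modulus principle does not apply to it directly. Multiplying
  \<open>f\<close> by \<open>exp (e * (z\<^sup>2 - 1))\<close>, which has modulus at most 1 on the strip and decays as the imaginary part grows,
  makes the modulus at most 1 on the horizontal sides of a tall enough rectangle as well; then
  \<open>e\<close> tends to 0.\<close>

lemma three_lines_unit:
  fixes f :: "complex \<Rightarrow> complex"
  assumes holf: "f holomorphic_on {z. 0 < Re z \<and> Re z < 1}"
    and contf: "continuous_on {z. 0 \<le> Re z \<and> Re z \<le> 1} f"
    and bound: "\<And>z. 0 \<le> Re z \<Longrightarrow> Re z \<le> 1 \<Longrightarrow> cmod (f z) \<le> B"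
    and left: "\<And>z. Re z = 0 \<Longrightarrow> cmod (f z) \<le> 1"
    and right: "\<And>z. Re z = 1 \<Longrightarrow> cmod (f z) \<le> 1"
    and w: "0 \<le> Re w" "Re w \<le> 1"
  shows "cmod (f w) \<le> 1"
proof -
  define K where "K = (Re w)\<^sup>2 - (Im w)\<^sup>2 - 1"
  have damped: "cmod (f w) * exp (e * K) \<le> 1" if "0 < e" for e :: real
  proof -
    define g where "g z = f z * exp (of_real e * (z\<^sup>2 - 1))" for z
    have norm_g: "cmod (g z) = cmod (f z) * exp (e * ((Re z)\<^sup>2 - (Im z)\<^sup>2 - 1))" for z
      by (simp add: g_def norm_mult power2_eq_square)
    \<comment> \<open>chosen so that \<open>w\<close> lies in the rectangle and \<open>B \<le> e * R\<^sup>2 \<le> exp (e * R\<^sup>2)\<close>\<close>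
    define R where "R = \<bar>Im w\<bar> + \<bar>B\<bar> / e + 1"
    have R: "1 \<le> R" "\<bar>Im w\<bar> \<le> R"
      using that by (auto simp: R_def)
    have "e * R = e * \<bar>Im w\<bar> + \<bar>B\<bar> + e"
      using that by (simp add: R_def field_simps)
    then have "B \<le> e * R"
      using that mult_nonneg_nonneg[of e "\<bar>Im w\<bar>"] by linarith
    have "B \<le> e * R\<^sup>2"
    proof -
      have "e * R \<le> e * R\<^sup>2"
        using R that self_le_power[of R 2] by simp
      with \<open>B \<le> e * R\<close> show ?thesis by linarith
    qed
    then have B_le: "B \<le> exp (e * R\<^sup>2)"
      using exp_ge_add_one_self[of "e * R\<^sup>2"] by linarith
    define S where "S = cbox (Complex 0 (-R)) (Complex 1 R)"
    have mem_S: "z \<in> S \<longleftrightarrow> 0 \<le> Re z \<and> Re z \<le> 1 \<and> \<bar>Im z\<bar> \<le> R" for z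
      by (auto simp: S_def in_cbox_complex_iff)
    have int_S: "interior S = {z. 0 < Re z \<and> Re z < 1 \<and> \<bar>Im z\<bar> < R}"
      by (auto simp: S_def interior_cbox in_box_complex_iff)
    have "cmod (g w) \<le> 1"
    proof (rule maximum_modulus_frontier[of g S])
      show "g holomorphic_on interior S"
        unfolding g_def int_S
        by (intro holomorphic_intros holomorphic_on_subset[OF holf]) auto
      have "continuous_on S g"
        unfolding g_def
        by (intro continuous_intros continuous_on_subset[OF contf]) (auto simp: mem_S)
      then show "continuous_on (closure S) g"
        by (simp add: S_def)
      show "bounded S" by (simp add: S_def bounded_cbox)
      show "w \<in> S" using w R by (simp add: mem_S)
      fix z assume "z \<in> frontier S"
      then have "z \<in> S" "z \<notin> interior S"
        by (auto simp: frontier_def S_def)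
      then have z: "0 \<le> Re z" "Re z \<le> 1" and "Re z = 0 \<or> Re z = 1 \<or> \<bar>Im z\<bar> = R"
        by (auto simp: mem_S int_S)
      have "(Re z)\<^sup>2 \<le> 1" using z by (simp add: power_le_one)
      then have exponent: "e * ((Re z)\<^sup>2 - (Im z)\<^sup>2 - 1) \<le> - (e * (Im z)\<^sup>2)"
        using that by (simp add: right_diff_distrib)
      moreover have "0 \<le> e * (Im z)\<^sup>2" using that by simp
      ultimately have damp: "exp (e * ((Re z)\<^sup>2 - (Im z)\<^sup>2 - 1)) \<le> 1"
        by (simp only: exp_le_one_iff)
      from \<open>Re z = 0 \<or> Re z = 1 \<or> \<bar>Im z\<bar> = R\<close> show "cmod (g z) \<le> 1"
      proof (elim disjE)
        assume "\<bar>Im z\<bar> = R"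
        then have "(Im z)\<^sup>2 = R\<^sup>2" by auto
        then have "cmod (g z) \<le> exp (e * R\<^sup>2) * exp (- (e * R\<^sup>2))"
          unfolding norm_g using exponent bound[OF z] B_le
          by (intro mult_mono) auto
        then show ?thesis by (simp flip: exp_add)
      next
        assume "Re z = 0"
        with left damp show ?thesis
          unfolding norm_g by (intro mult_le_one) auto
      next
        assume "Re z = 1"
        with right damp show ?thesis
          unfolding norm_g by (intro mult_le_one) auto
      qed
    qed
    then show ?thesis by (simp add: norm_g K_def)
  qed
  have lim: "((\<lambda>e. cmod (f w) * exp (e * K)) \<longlongrightarrow> cmod (f w) * exp (0 * K)) (at_right 0)"
    by (intro tendsto_intros)
  have "\<forall>\<^sub>F e in at_right 0. cmod (f w) * exp (e * K) \<le> 1"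
    using eventually_at_right_less by eventually_elim (rule damped)
  from tendsto_upperbound[OF lim this] show ?thesis by simp
qed

text \<open>The exponential \<open>C powr (1 - z) * D powr z\<close> has constant modulus on each side of the strip; dividing by
  it reduces the theorem to bounds equal to 1. To divide, \<open>C\<close> and \<open>D\<close> must be positive, so they are
  first increased by \<open>e > 0\<close>.\<close>

theorem three_lines:
  fixes f :: "complex \<Rightarrow> complex"
  assumes holf: "f holomorphic_on {z. 0 < Re z \<and> Re z < 1}"
    and contf: "continuous_on {z. 0 \<le> Re z \<and> Re z \<le> 1} f"
    and bound: "\<And>z. 0 \<le> Re z \<Longrightarrow> Re z \<le> 1 \<Longrightarrow> cmod (f z) \<le> B"
    and left: "\<And>z. Re z = 0 \<Longrightarrow> cmod (f z) \<le> C"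
    and right: "\<And>z. Re z = 1 \<Longrightarrow> cmod (f z) \<le> D"
    and w: "0 < Re w" "Re w < 1"
  shows "cmod (f w) \<le> C powr (1 - Re w) * D powr (Re w)"
proof -
  have CD: "0 \<le> C" "0 \<le> D"
    using left[of 0] right[of 1] norm_ge_zero order_trans
    by (auto intro: order_trans[OF norm_ge_zero])
  have pos: "cmod (f w) \<le> (C + e) powr (1 - Re w) * (D + e) powr (Re w)" if "0 < e" for e
  proof -
    define c where "c = ln (C + e)"
    define d where "d = ln (D + e)"
    define g where "g z = f z * exp (- ((1 - z) * of_real c + z * of_real d))" for z
    have norm_g: "cmod (g z) = cmod (f z) * exp (- ((1 - Re z) * c + Re z * d))" for z
      by (simp add: g_def norm_mult)
    define L where "L = \<bar>c\<bar> + \<bar>d\<bar>"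
    have exps: "exp c = C + e" "exp d = D + e"
      using CD that by (auto simp: c_def d_def)
    have "cmod (g w) \<le> 1"
    proof (rule three_lines_unit[where f = g and w = w and B = "\<bar>B\<bar> * exp L"])
      show "g holomorphic_on {z. 0 < Re z \<and> Re z < 1}"
        unfolding g_def by (intro holomorphic_intros holf)
      show "continuous_on {z. 0 \<le> Re z \<and> Re z \<le> 1} g"
        unfolding g_def by (intro continuous_intros contf)
      show "cmod (g z) \<le> \<bar>B\<bar> * exp L" if z: "0 \<le> Re z" "Re z \<le> 1" for z
      proof -
        have "- ((1 - Re z) * c) \<le> \<bar>c\<bar>"
          using z mult_left_le_one_le[of "\<bar>c\<bar>" "1 - Re z"] abs_ge_minus_self[of "(1 - Re z) * c"]
          by (simp add: abs_mult)
        moreover have "- (Re z * d) \<le> \<bar>d\<bar>"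
          using z mult_left_le_one_le[of "\<bar>d\<bar>" "Re z"] abs_ge_minus_self[of "Re z * d"]
          by (simp add: abs_mult)
        ultimately show ?thesis
          unfolding norm_g L_def using bound[OF z] by (intro mult_mono) auto
      qed
      show "cmod (g z) \<le> 1" if "Re z = 0" for z
        using left[OF that] that exps CD \<open>0 < e\<close> unfolding norm_g
        by (simp add: exp_minus field_simps)
      show "cmod (g z) \<le> 1" if "Re z = 1" for z
        using right[OF that] that exps CD \<open>0 < e\<close> unfolding norm_g
        by (simp add: exp_minus field_simps)
    qed (use w in auto)
    then have "cmod (f w) \<le> exp ((1 - Re w) * c + Re w * d)"
      unfolding norm_g exp_minus by (simp flip: divide_inverse add: pos_divide_le_eq)
    also have "\<dots> = (C + e) powr (1 - Re w) * (D + e) powr (Re w)"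
      using CD that by (simp add: exp_add powr_def c_def d_def)
    finally show ?thesis .
  qed
  have lim: "((\<lambda>e. (C + e) powr (1 - Re w) * (D + e) powr (Re w)) \<longlongrightarrow>
      (C + 0) powr (1 - Re w) * (D + 0) powr (Re w)) (at_right 0)"
    using w CD
    by (intro tendsto_mult tendsto_powr' tendsto_intros)
      (auto intro!: eventually_mono[OF eventually_at_right_less])
  have "\<forall>\<^sub>F e in at_right 0. cmod (f w) \<le> (C + e) powr (1 - Re w) * (D + e) powr (Re w)"
    using eventually_at_right_less by eventually_elim (rule pos)
  from tendsto_lowerbound[OF lim this] show ?thesis by simp
qed

section \<open>The norms as functions of the reciprocal exponent\<close>

text \<open>The parameter \<open>t\<close> is the reciprocal of the exponent, and \<open>inverse (ereal 0) = \<infinity>\<close>. In this parameter conjugate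
  exponents are \<open>t\<close> and \<open>1 - t\<close>, and interpolation runs along straight lines.\<close>

definition recip_norm :: "real \<Rightarrow> complex ^ 'n \<Rightarrow> real" where
  "recip_norm t x = lp_norm (inverse (ereal t)) x"

definition recip_opnorm :: "real \<Rightarrow> complex ^ 'n ^ 'n \<Rightarrow> real" where
  "recip_opnorm t A = lp_opnorm (inverse (ereal t)) A"

lemma recip_norm_0: "recip_norm 0 x = Max (range (\<lambda>i. cmod (x $ i)))"
  by (simp add: recip_norm_def lp_norm_def)

lemma recip_norm_pos:
  "0 < t \<Longrightarrow> recip_norm t x = (\<Sum>i\<in>UNIV. cmod (x $ i) powr (1 / t)) powr t"
  by (simp add: recip_norm_def lp_norm_def divide_inverse)

lemma recip_norm_mono:
  assumes "0 \<le> t" "\<And>i. cmod (x $ i) \<le> cmod (y $ i)"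
  shows "recip_norm t x \<le> recip_norm t y"
proof (cases "t = 0")
  case True
  have "cmod (x $ i) \<le> Max (range (\<lambda>i. cmod (y $ i)))" for i
    using assms(2)[of i] by (intro order_trans[OF _ Max_ge]) auto
  then show ?thesis
    by (auto simp: True recip_norm_0)
next
  case False
  with assms show ?thesis
    by (auto simp: recip_norm_pos intro!: powr_mono2 sum_mono sum_nonneg)
qed

lemma recip_norm_cong:
  assumes "\<And>i. cmod (x $ i) = cmod (y $ i)"
  shows "recip_norm t x = recip_norm t y"
  by (simp add: recip_norm_def lp_norm_def assms)

lemma component_le_recip_norm:
  assumes "0 \<le> t"
  shows "cmod (x $ i) \<le> recip_norm t x"
proof (cases "t = 0")
  case True
  then show ?thesis by (simp add: recip_norm_0)
next
  case False
  with assms have t: "0 < t" by simp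
  have "cmod (x $ i) = (cmod (x $ i) powr (1 / t)) powr t"
    using t by (simp add: powr_powr)
  also have "\<dots> \<le> (\<Sum>i\<in>UNIV. cmod (x $ i) powr (1 / t)) powr t"
    using t by (intro powr_mono2 member_le_sum) auto
  finally show ?thesis using t by (simp add: recip_norm_pos)
qed

lemma recip_norm_nonneg: "0 \<le> t \<Longrightarrow> 0 \<le> recip_norm t x"
  using component_le_recip_norm norm_ge_zero order_trans by blast

lemma recip_norm_eq_0_imp:
  assumes "0 \<le> t" "recip_norm t x = 0"
  shows "x = 0"
  using component_le_recip_norm[OF assms(1), of x] assms(2) by (simp add: vec_eq_iff)

lemma recip_norm_zero: "recip_norm t 0 = 0"
  by (simp add: recip_norm_def lp_norm_def)

lemma recip_norm_scale:
  assumes "0 \<le> t"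
  shows "recip_norm t (c *s x) = cmod c * recip_norm t x"
proof (cases "t = 0")
  case True
  have "range (\<lambda>i. cmod (c * x $ i)) = (\<lambda>r. cmod c * r) ` range (\<lambda>i. cmod (x $ i))"
    by (auto simp: norm_mult)
  moreover have "mono (\<lambda>r. cmod c * r)"
    by (simp add: mono_def mult_left_mono)
  ultimately show ?thesis
    by (simp add: True recip_norm_0 mono_Max_commute)
next
  case False
  with assms have "0 < t" by simp
  then show ?thesis
    by (simp add: recip_norm_pos norm_mult powr_mult powr_powr sum_nonneg flip: sum_distrib_left)
qed

lemma recip_norm_axis:
  assumes "0 \<le> t"
  shows "recip_norm t (axis i c) = cmod c"
proof (cases "t = 0")
  case True
  show ?thesis unfolding True recip_norm_0
    by (rule Max_eqI) (auto simp: axis_def intro!: image_eqI[of _ _ i])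
next
  case False
  with assms have "0 < t" by simp
  have "(\<Sum>j\<in>UNIV. cmod (axis i c $ j) powr (1 / t)) = cmod c powr (1 / t)"
    using sum.delta[of UNIV i "\<lambda>_. cmod c powr (1 / t)"]
    by (simp add: axis_def if_distrib if_distribR cong: if_cong)
  with \<open>0 < t\<close> show ?thesis
    by (simp add: recip_norm_pos powr_powr)
qed

lemma recip_opnorm_eq:
  "recip_opnorm t A = (SUP x\<in>{x. recip_norm t x = 1}. recip_norm t (A *v x))"
  unfolding recip_opnorm_def lp_opnorm_def recip_norm_def
  by (rule arg_cong[of _ _ Sup]) auto

text \<open>Needed because \<open>Sup\<close> of an unbounded set of reals carries no information. Every entry of a unit vector
  has modulus at most 1, so every entry of its image is at most the sum \<open>K\<close> of all the moduli of entries of \<open>A\<close>.\<close>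

lemma recip_norm_matrix_bounded:
  fixes A :: "complex ^ 'n ^ 'n"
  assumes "0 \<le> t"
  shows "bdd_above ((\<lambda>x. recip_norm t (A *v x)) ` {x. recip_norm t x = 1})"
proof -
  define K where "K = (\<Sum>i\<in>UNIV. \<Sum>j\<in>UNIV. cmod (A $ i $ j))"
  have "recip_norm t (A *v x) \<le> recip_norm t ((\<chi> i. of_real K) :: complex ^ 'n)"
    if "recip_norm t x = 1" for x :: "complex ^ 'n"
  proof (rule recip_norm_mono[OF assms])
    fix i
    have "cmod ((A *v x) $ i) \<le> (\<Sum>j\<in>UNIV. cmod (A $ i $ j) * cmod (x $ j))"
      by (auto simp: matrix_vector_mult_def simp flip: norm_mult intro!: sum_norm_le)
    also have "\<dots> \<le> (\<Sum>j\<in>UNIV. cmod (A $ i $ j))"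
      using component_le_recip_norm[OF assms, of x] that
      by (intro sum_mono mult_left_le) auto
    also have "\<dots> \<le> K"
      unfolding K_def
      by (rule member_le_sum[where f = "\<lambda>i. \<Sum>j\<in>UNIV. cmod (A $ i $ j)"]) (auto intro: sum_nonneg)
    finally show "cmod ((A *v x) $ i) \<le> cmod (((\<chi> i. of_real K) :: complex ^ 'n) $ i)"
      by simp
  qed
  then show ?thesis by (auto simp: bdd_above_def)
qed

lemma recip_opnorm_bound:
  fixes A :: "complex ^ 'n ^ 'n"
  assumes "0 \<le> t"
  shows "recip_norm t (A *v x) \<le> recip_opnorm t A * recip_norm t x"
proof (cases "x = 0")
  case True
  then show ?thesis by (simp add: recip_norm_zero)
next
  case False
  define r where "r = recip_norm t x"
  have r: "0 < r"
    using False recip_norm_nonneg[OF assms, of x] recip_norm_eq_0_imp[OF assms, of x]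
    by (force simp: r_def)
  define y where "y = of_real (1 / r) *s x"
  have "recip_norm t y = 1"
    using r by (simp only: y_def recip_norm_scale[OF assms] norm_of_real flip: r_def) simp
  then have "recip_norm t (A *v y) \<le> recip_opnorm t A"
    unfolding recip_opnorm_eq by (intro cSUP_upper recip_norm_matrix_bounded assms) auto
  also have "recip_norm t (A *v y) = recip_norm t (A *v x) / r"
    using r by (simp add: y_def recip_norm_scale[OF assms] norm_divide vector_scalar_commute)
  finally show ?thesis using r by (simp add: r_def field_simps)
qed

lemma recip_opnorm_least:
  fixes A :: "complex ^ 'n ^ 'n"
  assumes "0 \<le> t" "\<And>x. recip_norm t x = 1 \<Longrightarrow> recip_norm t (A *v x) \<le> C"
  shows "recip_opnorm t A \<le> C"
  unfolding recip_opnorm_eq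
proof (rule cSUP_least)
  have "recip_norm t (axis undefined 1 :: complex ^ 'n) = 1"
    using assms(1) by (simp add: recip_norm_axis)
  then show "{x :: complex ^ 'n. recip_norm t x = 1} \<noteq> {}" by blast
qed (use assms in auto)

lemma recip_opnorm_nonneg:
  fixes A :: "complex ^ 'n ^ 'n"
  assumes "0 \<le> t"
  shows "0 \<le> recip_opnorm t A"
proof -
  have "0 \<le> recip_norm t (A *v axis undefined 1)"
    by (rule recip_norm_nonneg[OF assms])
  also have "\<dots> \<le> recip_opnorm t A"
    using recip_opnorm_bound[OF assms, of A "axis undefined 1"] assms by (simp add: recip_norm_axis)
  finally show ?thesis .
qed

section \<open>Duality\<close>

text \<open>Young's inequality, summed after dividing both families by their sums. If one of the sums vanishes or
  the index set is infinite, both sides are 0.\<close>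

lemma Holder_sum_powr:
  fixes a b :: "'a \<Rightarrow> real"
  assumes "0 < t" "t < 1" and a: "\<And>i. 0 \<le> a i" and b: "\<And>i. 0 \<le> b i"
  shows "(\<Sum>i\<in>I. a i powr t * b i powr (1 - t)) \<le> (\<Sum>i\<in>I. a i) powr t * (\<Sum>i\<in>I. b i) powr (1 - t)"
proof (cases "finite I \<and> 0 < sum a I \<and> 0 < sum b I")
  case True
  define S where "S = sum a I"
  define T where "T = sum b I"
  have pos: "0 < S" "0 < T" using True by (auto simp: S_def T_def)
  have young: "(a i / S) powr t * (b i / T) powr (1 - t) \<le> t * (a i / S) + (1 - t) * (b i / T)" for i
  proof (cases "a i = 0 \<or> b i = 0")
    case True
    then show ?thesis using assms pos a[of i] b[of i] by auto
  next
    case False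
    then show ?thesis
      using assms pos a[of i] b[of i] by (intro Youngs_inequality_0) (auto simp: less_le)
  qed
  have "(\<Sum>i\<in>I. a i powr t * b i powr (1 - t)) / (S powr t * T powr (1 - t))
      = (\<Sum>i\<in>I. (a i / S) powr t * (b i / T) powr (1 - t))"
    using a b pos by (simp add: powr_divide sum_divide_distrib)
  also have "\<dots> \<le> (\<Sum>i\<in>I. t * (a i / S) + (1 - t) * (b i / T))"
    by (intro sum_mono young)
  also have "\<dots> = 1"
    using pos by (simp add: sum.distrib S_def T_def flip: sum_distrib_left sum_divide_distrib)
  finally show ?thesis
    using pos by (simp add: S_def T_def)
next
  case False
  then consider "infinite I" | "finite I" "sum a I = 0" | "finite I" "sum b I = 0"
    using sum_nonneg[of I a] sum_nonneg[of I b] a b by fastforce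
  then have "(\<Sum>i\<in>I. a i powr t * b i powr (1 - t)) = 0"
    using a b by cases (auto simp: sum_nonneg_eq_0_iff intro!: sum.neutral)
  then show ?thesis by simp
qed

lemma Holder_recip_norm:
  assumes "0 \<le> t" "t \<le> 1"
  shows "cmod (\<Sum>i\<in>UNIV. x $ i * y $ i) \<le> recip_norm t x * recip_norm (1 - t) y"
proof -
  have tri: "cmod (\<Sum>i\<in>UNIV. x $ i * y $ i) \<le> (\<Sum>i\<in>UNIV. cmod (x $ i) * cmod (y $ i))"
    by (auto simp flip: norm_mult intro!: sum_norm_le)
  consider "t = 0" | "t = 1" | "0 < t" "t < 1" using assms by linarith
  then have "(\<Sum>i\<in>UNIV. cmod (x $ i) * cmod (y $ i)) \<le> recip_norm t x * recip_norm (1 - t) y"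
  proof cases
    case 1
    have "(\<Sum>i\<in>UNIV. cmod (x $ i) * cmod (y $ i)) \<le> (\<Sum>i\<in>UNIV. recip_norm 0 x * cmod (y $ i))"
      by (intro sum_mono mult_right_mono component_le_recip_norm) auto
    then show ?thesis by (simp add: 1 recip_norm_pos sum_nonneg flip: sum_distrib_left)
  next
    case 2
    have "(\<Sum>i\<in>UNIV. cmod (x $ i) * cmod (y $ i)) \<le> (\<Sum>i\<in>UNIV. cmod (x $ i) * recip_norm 0 y)"
      by (intro sum_mono mult_left_mono component_le_recip_norm) auto
    then show ?thesis by (simp add: 2 recip_norm_pos sum_nonneg flip: sum_distrib_right)
  next
    case 3
    then show ?thesis
      using Holder_sum_powr[OF 3, of "\<lambda>i. cmod (x $ i) powr (1 / t)"
          "\<lambda>i. cmod (y $ i) powr (1 / (1 - t))" UNIV]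
      by (simp add: recip_norm_pos powr_powr)
  qed
  with tri show ?thesis by linarith
qed

text \<open>Equality in Holder's inequality is attained by \<open>y\<^sub>i = cnj (sgn z\<^sub>i) * \<bar>z\<^sub>i\<bar> powr (1 / t - 1)\<close>, suitably
  scaled. For \<open>t = 1\<close> the modulus of \<open>y\<^sub>i\<close> is 1 where \<open>z\<^sub>i \<noteq> 0\<close>. For \<open>t = 0\<close> the formula makes no sense, and
  \<open>y\<close> is concentrated on a coordinate where \<open>z\<close> has its largest modulus.\<close>

lemma norming_vector:
  fixes z :: "complex ^ 'n"
  assumes "0 \<le> t" "t \<le> 1"
  obtains y where "recip_norm (1 - t) y = 1" "(\<Sum>i\<in>UNIV. z $ i * y $ i) = of_real (recip_norm t z)"
proof -
  have mult_cnj_sgn: "w * cnj (sgn w) = of_real (cmod w)" for w :: complex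
    by (cases "w = 0") (auto simp: sgn_eq complex_norm_square[symmetric] power2_eq_square)
  consider "z = 0" | "z \<noteq> 0" "t = 0" | "z \<noteq> 0" "0 < t" using assms by linarith
  then show thesis
  proof cases
    case 1
    then show thesis
      using assms by (intro that[of "axis undefined 1"]) (auto simp: recip_norm_axis recip_norm_zero)
  next
    case 2
    have "Max (range (\<lambda>i. cmod (z $ i))) \<in> range (\<lambda>i. cmod (z $ i))"
      by (rule Max_in) auto
    then obtain k where k: "recip_norm 0 z = cmod (z $ k)"
      unfolding recip_norm_0 by blast
    with 2 have "z $ k \<noteq> 0"
      using recip_norm_eq_0_imp[of 0 z] by auto
    moreover have "(\<Sum>i\<in>UNIV. z $ i * axis k (cnj (sgn (z $ k))) $ i) = z $ k * cnj (sgn (z $ k))"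
      using sum.delta[of UNIV k "\<lambda>i. z $ i * cnj (sgn (z $ k))"]
      by (simp add: axis_def if_distrib cong: if_cong)
    ultimately show thesis
      using 2 k by (intro that[of "axis k (cnj (sgn (z $ k)))"])
        (auto simp: recip_norm_axis norm_sgn mult_cnj_sgn)
  next
    case 3
    define S where "S = (\<Sum>i\<in>UNIV. cmod (z $ i) powr (1 / t))"
    obtain k where k: "z $ k \<noteq> 0" using 3 by (auto simp: vec_eq_iff)
    have "0 < S"
      unfolding S_def using k by (intro sum_pos2[of _ k]) auto
    have norm_z: "recip_norm t z = S powr t"
      using 3 by (simp add: recip_norm_pos S_def)
    define y :: "complex ^ 'n" where
      "y = (\<chi> i. cnj (sgn (z $ i)) * of_real (cmod (z $ i) powr (1 / t - 1) / S powr (1 - t)))"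
    have norm_y: "cmod (y $ i) = (if z $ i = 0 then 0 else cmod (z $ i) powr (1 / t - 1) / S powr (1 - t))" for i
      by (simp add: y_def norm_mult norm_sgn norm_divide)
    have "recip_norm (1 - t) y = 1"
    proof (cases "t = 1")
      case True
      show ?thesis unfolding True diff_self recip_norm_0
      proof (rule Max_eqI)
        show "1 \<in> range (\<lambda>i. cmod (y $ i))"
          using k \<open>0 < S\<close> by (auto simp: norm_y True intro!: image_eqI[of _ _ k])
      qed (auto simp: norm_y True \<open>0 < S\<close>)
    next
      case False
      then have t1: "t < 1" using assms by simp
      have exponent: "(1 / t - 1) / (1 - t) = 1 / t"
        using t1 3 by (simp add: field_simps)
      have "cmod (y $ i) powr (1 / (1 - t)) = cmod (z $ i) powr (1 / t) / S" for i
        using t1 3 \<open>0 < S\<close> by (simp add: norm_y powr_divide powr_powr exponent)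
      then have "(\<Sum>i\<in>UNIV. cmod (y $ i) powr (1 / (1 - t))) = 1"
        using \<open>0 < S\<close> by (simp add: S_def flip: sum_divide_distrib)
      then show ?thesis using t1 by (simp add: recip_norm_pos)
    qed
    moreover have "(\<Sum>i\<in>UNIV. z $ i * y $ i) = of_real (recip_norm t z)"
    proof -
      have "z $ i * y $ i = of_real (cmod (z $ i) powr (1 / t) / S powr (1 - t))" for i
      proof -
        have "z $ i * y $ i = (z $ i * cnj (sgn (z $ i)))
            * of_real (cmod (z $ i) powr (1 / t - 1) / S powr (1 - t))"
          by (simp add: y_def)
        also have "\<dots> = of_real (cmod (z $ i) * cmod (z $ i) powr (1 / t - 1) / S powr (1 - t))"
          by (simp add: mult_cnj_sgn)
        also have "cmod (z $ i) * cmod (z $ i) powr (1 / t - 1) = cmod (z $ i) powr (1 / t)"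
          using powr_mult_base[of "cmod (z $ i)" "1 / t - 1"] by simp
        finally show ?thesis .
      qed
      then have "(\<Sum>i\<in>UNIV. z $ i * y $ i) = of_real (S / S powr (1 - t))"
        by (simp add: S_def flip: sum_divide_distrib)
      also have "S / S powr (1 - t) = S powr t"
        using \<open>0 < S\<close> powr_diff[of S 1 "1 - t"] by simp
      finally show ?thesis by (simp add: norm_z)
    qed
    ultimately show thesis by (rule that)
  qed
qed

text \<open>A norming vector \<open>y\<close> turns the norm of \<open>A x\<close> into the pairing of \<open>A x\<close> with \<open>y\<close>, and the transpose of \<open>A\<close> moves
  to \<open>y\<close>. The transpose differs from the adjoint only by entrywise conjugation, which preserves all
  the norms.\<close>

lemma recip_opnorm_le_dual:
  fixes A :: "complex ^ 'n ^ 'n"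
  assumes t: "0 \<le> t" "t \<le> 1"
  shows "recip_opnorm t A \<le> recip_opnorm (1 - t) (conj_transpose A)"
proof (rule recip_opnorm_least[OF t(1)])
  fix x :: "complex ^ 'n"
  assume x: "recip_norm t x = 1"
  obtain y where y: "recip_norm (1 - t) y = 1"
    and xy: "(\<Sum>i\<in>UNIV. (A *v x) $ i * y $ i) = of_real (recip_norm t (A *v x))"
    using norming_vector[OF t] by metis
  define u where "u = conj_transpose A *v (\<chi> i. cnj (y $ i))"
  have "(\<Sum>i\<in>UNIV. (A *v x) $ i * y $ i) = (\<Sum>j\<in>UNIV. x $ j * (\<chi> j. cnj (u $ j)) $ j)"
    unfolding u_def conj_transpose_def matrix_vector_mult_def
    by (simp add: sum_distrib_left sum_distrib_right mult_ac)
      (rule sum.swap)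
  then have "recip_norm t (A *v x) = cmod (\<Sum>j\<in>UNIV. x $ j * (\<chi> j. cnj (u $ j)) $ j)"
    using xy recip_norm_nonneg[OF t(1)] by (metis norm_of_real abs_of_nonneg)
  also have "\<dots> \<le> recip_norm t x * recip_norm (1 - t) (\<chi> j. cnj (u $ j))"
    by (rule Holder_recip_norm[OF t])
  also have "\<dots> = recip_norm (1 - t) u"
    by (simp add: x) (rule recip_norm_cong, simp)
  also have "\<dots> \<le> recip_opnorm (1 - t) (conj_transpose A) * recip_norm (1 - t) (\<chi> i. cnj (y $ i))"
    unfolding u_def using t by (intro recip_opnorm_bound) simp
  also have "recip_norm (1 - t) (\<chi> i. cnj (y $ i)) = recip_norm (1 - t) y"
    by (rule recip_norm_cong) simp
  finally show "recip_norm t (A *v x) \<le> recip_opnorm (1 - t) (conj_transpose A)"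
    by (simp add: y)
qed

section \<open>Interpolation\<close>

text \<open>For a probability vector \<open>a\<close> and phases \<open>u\<close>, this is the curve of vectors in the proof of the Riesz-Thorin
  theorem: at a complex parameter \<open>s\<close> it lies in the unit ball belonging to \<open>Re s\<close>. Since
  \<open>0 powr s = 0\<close> for all \<open>s\<close>, it is holomorphic in \<open>s\<close> even where \<open>a\<close> vanishes.\<close>

definition powr_vec :: "('n \<Rightarrow> complex) \<Rightarrow> ('n \<Rightarrow> real) \<Rightarrow> complex \<Rightarrow> complex ^ 'n" where
  "powr_vec u a s = (\<chi> i. u i * of_real (a i) powr s)"

lemma unit_vector_powr_vec:
  assumes "0 < r" "recip_norm r x = 1"
  obtains u a where "\<And>i. cmod (u i) \<le> 1" "\<And>i. 0 \<le> a i" "sum a UNIV = 1"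
    "x = powr_vec u a (of_real r)"
proof (rule that)
  show "cmod (sgn (x $ i)) \<le> 1" for i by (simp add: norm_sgn)
  show "0 \<le> cmod (x $ i) powr (1 / r)" for i by simp
  have "(\<Sum>i\<in>UNIV. cmod (x $ i) powr (1 / r)) = ((\<Sum>i\<in>UNIV. cmod (x $ i) powr (1 / r)) powr r) powr (1 / r)"
    using assms(1) by (simp add: powr_powr sum_nonneg)
  then show "(\<Sum>i\<in>UNIV. cmod (x $ i) powr (1 / r)) = 1"
    using assms by (simp add: recip_norm_pos)
  have "x $ i = sgn (x $ i) * of_real (cmod (x $ i) powr (1 / r)) powr of_real r" for i
    using assms(1) by (simp add: powr_of_real powr_powr sgn_eq)
  then show "x = powr_vec (\<lambda>i. sgn (x $ i)) (\<lambda>i. cmod (x $ i) powr (1 / r)) (of_real r)"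
    by (simp add: powr_vec_def vec_eq_iff)
qed

lemma recip_norm_powr_vec_le_1:
  assumes u: "\<And>i. cmod (u i) \<le> 1" and a: "\<And>i. 0 \<le> a i" "sum a UNIV = 1" and s: "0 \<le> Re s"
  shows "recip_norm (Re s) (powr_vec u a s) \<le> 1"
proof -
  have le: "cmod (powr_vec u a s $ i) \<le> a i powr Re s" for i
    using u[of i] a(1)[of i] by (simp add: powr_vec_def norm_mult norm_powr_real_powr mult_left_le_one_le)
  show ?thesis
  proof (cases "Re s = 0")
    case True
    have "cmod (powr_vec u a s $ i) \<le> 1" for i
      using le[of i] by (simp add: True split: if_splits)
    then show ?thesis by (auto simp: True recip_norm_0)
  next
    case False
    with s have s: "0 < Re s" by simp
    have "cmod (powr_vec u a s $ i) powr (1 / Re s) \<le> a i" for i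
      using powr_mono2[OF _ _ le[of i], of "1 / Re s"] s a(1)[of i] by (simp add: powr_powr)
    then have "(\<Sum>i\<in>UNIV. cmod (powr_vec u a s $ i) powr (1 / Re s)) \<le> 1"
      unfolding a(2)[symmetric] by (rule sum_mono)
    then show ?thesis using s by (simp add: recip_norm_pos powr_le1 sum_nonneg)
  qed
qed

text \<open>If \<open>s = t\<close> there is nothing to interpolate. Otherwise the intermediate parameter \<open>r\<close> lies strictly between 0 and 1,
  so that a unit vector \<open>x\<close> and a vector \<open>y\<close> norming \<open>A x\<close> both lie on curves \<open>powr_vec\<close>. Pairing the
  image of the first curve with the second gives a holomorphic \<open>F\<close> on the strip, bounded on its two
  sides by the operator norms for \<open>s\<close> and \<open>t\<close>, and equal at \<open>\<theta>\<close> to the norm of \<open>A x\<close>.\<close>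

theorem Riesz_Thorin:
  fixes A :: "complex ^ 'n ^ 'n"
  assumes s: "0 \<le> s" "s \<le> 1" and t: "0 \<le> t" "t \<le> 1" and \<theta>: "0 < \<theta>" "\<theta> < 1"
  shows "recip_opnorm ((1 - \<theta>) * s + \<theta> * t) A \<le> recip_opnorm s A powr (1 - \<theta>) * recip_opnorm t A powr \<theta>"
proof (cases "s = t")
  case True
  have "(1 - \<theta>) * t + \<theta> * t = t" by (simp add: algebra_simps)
  then show ?thesis
    using recip_opnorm_nonneg[OF t(1), of A] by (simp add: True flip: powr_add)
next
  case False
  define r where "r = (1 - \<theta>) * s + \<theta> * t"
  define \<sigma> where "\<sigma> z = (1 - z) * of_real s + z * of_real t" for z :: complex
  have Re_\<sigma>: "Re (\<sigma> z) = (1 - Re z) * s + Re z * t" for z by (simp add: \<sigma>_def)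
  have \<sigma>_range: "0 \<le> Re (\<sigma> z)" "Re (\<sigma> z) \<le> 1" if "0 \<le> Re z" "Re z \<le> 1" for z
    unfolding Re_\<sigma> using that s t convex_bound_le[of s 1 t "1 - Re z" "Re z"] by auto
  have "0 < r"
    unfolding r_def using s t \<theta> False
    by (cases "s = 0") (auto intro: add_pos_nonneg)
  moreover have "r < 1"
  proof -
    have "0 < (1 - \<theta>) * (1 - s) + \<theta> * (1 - t)"
      using s t \<theta> False by (cases "s = 1") (auto intro: add_pos_nonneg)
    then show ?thesis by (simp add: r_def algebra_simps)
  qed
  ultimately have r: "0 < r" "r < 1" .
  have "recip_opnorm r A \<le> recip_opnorm s A powr (1 - \<theta>) * recip_opnorm t A powr \<theta>"
  proof (rule recip_opnorm_least)
    show "0 \<le> r" using r by simp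
    fix x :: "complex ^ 'n"
    assume x: "recip_norm r x = 1"
    obtain y where y: "recip_norm (1 - r) y = 1"
      and xy: "(\<Sum>i\<in>UNIV. (A *v x) $ i * y $ i) = of_real (recip_norm r (A *v x))"
      using norming_vector[of r "A *v x"] r by auto
    obtain u a where u: "\<And>i. cmod (u i) \<le> 1" and a: "\<And>i. 0 \<le> a i" "sum a UNIV = 1"
      and x_eq: "x = powr_vec u a (of_real r)"
      using unit_vector_powr_vec[OF r(1) x] by metis
    obtain v b where v: "\<And>i. cmod (v i) \<le> 1" and b: "\<And>i. 0 \<le> b i" "sum b UNIV = 1"
      and y_eq: "y = powr_vec v b (of_real (1 - r))"
      using unit_vector_powr_vec[OF _ y] r by (metis diff_gt_0_iff_gt)
    define X where "X z = powr_vec u a (\<sigma> z)" for z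
    define Y where "Y z = powr_vec v b (1 - \<sigma> z)" for z
    define F where "F z = (\<Sum>i\<in>UNIV. (A *v X z) $ i * Y z $ i)" for z
    have X1: "recip_norm (Re (\<sigma> z)) (X z) \<le> 1" if "0 \<le> Re z" "Re z \<le> 1" for z
      unfolding X_def using \<sigma>_range[OF that] by (intro recip_norm_powr_vec_le_1 u a)
    have Y1: "recip_norm (1 - Re (\<sigma> z)) (Y z) \<le> 1" if "0 \<le> Re z" "Re z \<le> 1" for z
      unfolding Y_def using \<sigma>_range[OF that] recip_norm_powr_vec_le_1[OF v b, of "1 - \<sigma> z"] by simp
    have F_le: "cmod (F z) \<le> recip_opnorm (Re (\<sigma> z)) A" if "0 \<le> Re z" "Re z \<le> 1" for z
    proof -
      note \<sigma> = \<sigma>_range[OF that]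
      have "cmod (F z) \<le> recip_norm (Re (\<sigma> z)) (A *v X z) * recip_norm (1 - Re (\<sigma> z)) (Y z)"
        unfolding F_def by (rule Holder_recip_norm[OF \<sigma>])
      also have "\<dots> \<le> recip_norm (Re (\<sigma> z)) (A *v X z)"
        using Y1[OF that] \<sigma> by (intro mult_left_le recip_norm_nonneg) auto
      also have "\<dots> \<le> recip_opnorm (Re (\<sigma> z)) A * recip_norm (Re (\<sigma> z)) (X z)"
        by (rule recip_opnorm_bound[OF \<sigma>(1)])
      also have "\<dots> \<le> recip_opnorm (Re (\<sigma> z)) A"
        using X1[OF that] \<sigma> by (intro mult_left_le recip_opnorm_nonneg) auto
      finally show ?thesis .
    qed
    have hol: "F holomorphic_on UNIV"
    proof -
      have F_eq: "F z = (\<Sum>i\<in>UNIV. (\<Sum>j\<in>UNIV. A $ i $ j * (u j * of_real (a j) powr (\<sigma> z)))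
          * (v i * of_real (b i) powr (1 - \<sigma> z)))" for z
        by (simp add: F_def X_def Y_def powr_vec_def matrix_vector_mult_def)
      show ?thesis
        unfolding F_eq \<sigma>_def by (intro holomorphic_intros)
    qed
    have "cmod (F (of_real \<theta>)) \<le> recip_opnorm s A powr (1 - Re (of_real \<theta>)) * recip_opnorm t A powr Re (of_real \<theta>)"
    proof (rule three_lines)
      show "F holomorphic_on {z. 0 < Re z \<and> Re z < 1}"
        using hol by (rule holomorphic_on_subset) auto
      show "continuous_on {z. 0 \<le> Re z \<and> Re z \<le> 1} F"
        using hol holomorphic_on_imp_continuous_on continuous_on_subset by blast
      show "cmod (F z) \<le> recip_opnorm s A" if "Re z = 0" for z
        using F_le[of z] that by (simp add: Re_\<sigma>)
      show "cmod (F z) \<le> recip_opnorm t A" if "Re z = 1" for z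
        using F_le[of z] that by (simp add: Re_\<sigma>)
      \<comment> \<open>the crude bound on the whole strip: both curves have entries of modulus at most 1\<close>
      show "cmod (F z) \<le> (\<Sum>i\<in>UNIV. \<Sum>j\<in>UNIV. cmod (A $ i $ j))" if z: "0 \<le> Re z" "Re z \<le> 1" for z
      proof -
        have Xj: "cmod (X z $ j) \<le> 1" for j
          using component_le_recip_norm[of "Re (\<sigma> z)" "X z" j] X1[OF z] \<sigma>_range[OF z] by linarith
        have Yi: "cmod (Y z $ i) \<le> 1" for i
          using component_le_recip_norm[of "1 - Re (\<sigma> z)" "Y z" i] Y1[OF z] \<sigma>_range[OF z] by linarith
        show ?thesis
          unfolding F_def matrix_vector_mult_def
        proof (simp add: sum_distrib_right, intro sum_norm_le)
          fix i j
          have "cmod (X z $ j) * cmod (Y z $ i) \<le> 1"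
            using Xj Yi by (intro mult_le_one) auto
          then show "cmod (A $ i $ j * X z $ j * Y z $ i) \<le> cmod (A $ i $ j)"
            by (simp add: norm_mult mult.assoc mult_left_le)
        qed
      qed
    qed (use \<theta> in auto)
    moreover have "F (of_real \<theta>) = of_real (recip_norm r (A *v x))"
    proof -
      have "\<sigma> (of_real \<theta>) = of_real r" by (simp add: \<sigma>_def r_def)
      then show ?thesis using xy by (simp add: F_def X_def Y_def x_eq y_eq)
    qed
    ultimately show "recip_norm r (A *v x) \<le> recip_opnorm s A powr (1 - \<theta>) * recip_opnorm t A powr \<theta>"
      using recip_norm_nonneg[of r "A *v x"] r by simp
  qed
  then show ?thesis by (simp add: r_def)
qed

section \<open>Hermitian matrices\<close>

lemma Hermitian_recip_opnorm_sym:
  assumes "A = conj_transpose A" "0 \<le> t" "t \<le> 1"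
  shows "recip_opnorm (1 - t) A = recip_opnorm t A"
  using recip_opnorm_le_dual[of t A] recip_opnorm_le_dual[of "1 - t" A] assms by simp

text \<open>The point \<open>r\<close> lies between \<open>t\<close> and its mirror image \<open>1 - t\<close>, where the operator norms agree, so
  log-convexity bounds the norm at \<open>r\<close> by their common value.\<close>

lemma Hermitian_recip_opnorm_mono:
  assumes A: "A = conj_transpose A" and t: "0 \<le> t" "t \<le> 1"
    and closer: "\<bar>r - 1/2\<bar> \<le> \<bar>t - 1/2\<bar>"
  shows "recip_opnorm r A \<le> recip_opnorm t A"
proof -
  note sym = Hermitian_recip_opnorm_sym[OF A t]
  consider "r = t" | "r = 1 - t" | "\<bar>r - 1/2\<bar> < \<bar>t - 1/2\<bar>"
    using closer by argo
  then show ?thesis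
  proof cases
    case 3
    \<comment> \<open>the weight for which \<open>r = (1 - \<theta>) * t + \<theta> * (1 - t)\<close>\<close>
    define \<theta> where "\<theta> = (r - t) / (1 - 2 * t)"
    have ne: "1 - 2 * t \<noteq> 0" using 3 by auto
    have \<theta>: "0 < \<theta>" "\<theta> < 1"
      using 3 by (auto simp: \<theta>_def field_simps abs_if split: if_splits)
    have "\<theta> * (1 - 2 * t) = r - t" using ne by (simp add: \<theta>_def)
    then have "(1 - \<theta>) * t + \<theta> * (1 - t) = r"
      by (simp add: algebra_simps)
    then have "recip_opnorm r A \<le> recip_opnorm t A powr (1 - \<theta>) * recip_opnorm t A powr \<theta>"
      using Riesz_Thorin[of t "1 - t" \<theta> A] t \<theta> sym by simp
    then show ?thesis
      using recip_opnorm_nonneg[OF t(1), of A] by (simp flip: powr_add)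
  qed (use sym in auto)
qed

lemma exponent_eq_inverse:
  assumes "(1::ereal) \<le> p"
  obtains t where "0 \<le> t" "t \<le> 1" "p = inverse (ereal t)"
proof (cases p)
  case (real q)
  with assms show thesis by (intro that[of "1 / q"]) (auto simp: divide_simps)
next
  case PInf
  then show thesis by (intro that[of 0]) auto
qed (use assms in auto)

lemma inverse_exponent_le:
  assumes "0 \<le> s" "0 \<le> t" "inverse (ereal s) \<le> inverse (ereal t)"
  shows "t \<le> s"
  using assms by (cases "s = 0"; cases "t = 0") (auto simp: inverse_le_iff)

theorem corollary3p3:
  fixes A :: "complex ^ 'n ^ 'n"
  assumes "A = conj_transpose A"
  shows "(\<forall>p::ereal. 1 \<le> p \<longrightarrow>
            lp_opnorm 2 A \<le> lp_opnorm p A \<and> lp_opnorm p A \<le> lp_opnorm 1 A) \<and>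
         lp_opnorm 1 A = lp_opnorm \<infinity> A \<and>
         antimono_on {1..2} (\<lambda>p. lp_opnorm p A) \<and>
         mono_on {2..\<infinity>} (\<lambda>p. lp_opnorm p A) \<and>
         (\<forall>p::real. 1 < p \<and> p < 2 \<longrightarrow>
            lp_opnorm (ereal p) A
              \<le> lp_opnorm 1 A powr ((2 - p) / p) * lp_opnorm 2 A powr (2 * (p - 1) / p)) \<and>
         (\<forall>p::real. 2 < p \<longrightarrow>
            lp_opnorm (ereal p) A
              \<le> lp_opnorm 2 A powr (2 / p) * lp_opnorm \<infinity> A powr ((p - 2) / p))"
proof (intro conjI allI impI)
  note mono = Hermitian_recip_opnorm_mono[OF assms]
  have two: "(2::ereal) = inverse (ereal (1/2))"
    by (simp add: numeral_eq_ereal)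
  have op1: "lp_opnorm 1 A = recip_opnorm 1 A"
    by (simp add: recip_opnorm_def one_ereal_def)
  have op2: "lp_opnorm 2 A = recip_opnorm (1/2) A"
    by (simp only: recip_opnorm_def two)
  have opinf: "lp_opnorm \<infinity> A = recip_opnorm 0 A"
    by (simp add: recip_opnorm_def)
  have opp: "lp_opnorm (ereal p) A = recip_opnorm (1 / p) A" if "0 < p" for p
    using that by (simp add: recip_opnorm_def divide_inverse)
  show "lp_opnorm 1 A = lp_opnorm \<infinity> A"
    using Hermitian_recip_opnorm_sym[OF assms, of 0] by (simp add: op1 opinf)
  {
    fix p :: ereal
    assume "1 \<le> p"
    then obtain t where t: "0 \<le> t" "t \<le> 1" and p: "p = inverse (ereal t)"
      by (rule exponent_eq_inverse)
    show "lp_opnorm 2 A \<le> lp_opnorm p A"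
      using mono[of t "1/2"] t by (simp only: op2 p flip: recip_opnorm_def)
    show "lp_opnorm p A \<le> lp_opnorm 1 A"
      using mono[of 1 t] t by (simp only: op1 p flip: recip_opnorm_def)
  }
  show "antimono_on {1..2} (\<lambda>p. lp_opnorm p A)"
  proof (rule monotone_onI)
    fix p q :: ereal
    assume pq: "p \<in> {1..2}" "q \<in> {1..2}" "p \<le> q"
    obtain s where s: "0 \<le> s" "s \<le> 1" "p = inverse (ereal s)"
      using exponent_eq_inverse[of p] pq by auto
    obtain t where t: "0 \<le> t" "t \<le> 1" "q = inverse (ereal t)"
      using exponent_eq_inverse[of q] pq by auto
    have "t \<le> s" using inverse_exponent_le[of s t] s t pq by simp
    moreover have "1/2 \<le> t" using inverse_exponent_le[of t "1/2"] t pq unfolding two by simp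
    ultimately show "lp_opnorm p A \<ge> lp_opnorm q A"
      using mono[of s t] s t by (simp only: flip: recip_opnorm_def)
  qed
  show "mono_on {2..\<infinity>} (\<lambda>p. lp_opnorm p A)"
  proof (rule monotone_onI)
    fix p q :: ereal
    assume pq: "p \<in> {2..\<infinity>}" "q \<in> {2..\<infinity>}" "p \<le> q"
    have "(1::ereal) \<le> 2" by simp
    with pq have "1 \<le> p" "1 \<le> q" by (metis atLeastAtMost_iff order_trans)+
    obtain s where s: "0 \<le> s" "s \<le> 1" "p = inverse (ereal s)"
      using exponent_eq_inverse[OF \<open>1 \<le> p\<close>] .
    obtain t where t: "0 \<le> t" "t \<le> 1" "q = inverse (ereal t)"
      using exponent_eq_inverse[OF \<open>1 \<le> q\<close>] .
    have "t \<le> s" using inverse_exponent_le[of s t] s t pq by simp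
    moreover have "s \<le> 1/2" using inverse_exponent_le[of "1/2" s] s pq unfolding two by simp
    ultimately show "lp_opnorm p A \<le> lp_opnorm q A"
      using mono[of t s] s t by (simp only: flip: recip_opnorm_def)
  qed
  show "lp_opnorm (ereal p) A
      \<le> lp_opnorm 1 A powr ((2 - p) / p) * lp_opnorm 2 A powr (2 * (p - 1) / p)"
    if "1 < p \<and> p < 2" for p
  proof -
    \<comment> \<open>\<open>1 / p\<close> lies between the parameters 1 and 1/2, and \<open>\<theta>\<close> is the weight of 1/2\<close>
    define \<theta> where "\<theta> = 2 * (p - 1) / p"
    have "0 < \<theta>" "\<theta> < 1" "1 - \<theta> = (2 - p) / p" "(1 - \<theta>) * 1 + \<theta> * (1/2) = 1 / p"
      using that by (auto simp: \<theta>_def field_simps)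
    then show ?thesis
      using Riesz_Thorin[of 1 "1/2" \<theta> A] that by (simp add: opp op1 op2 \<theta>_def)
  qed
  show "lp_opnorm (ereal p) A
      \<le> lp_opnorm 2 A powr (2 / p) * lp_opnorm \<infinity> A powr ((p - 2) / p)"
    if "2 < p" for p
  proof -
    \<comment> \<open>\<open>1 / p\<close> lies between the parameters 1/2 and 0, and \<open>\<theta>\<close> is the weight of 0\<close>
    define \<theta> where "\<theta> = (p - 2) / p"
    have "0 < \<theta>" "\<theta> < 1" "1 - \<theta> = 2 / p" "(1 - \<theta>) * (1/2) + \<theta> * 0 = 1 / p"
      using that by (auto simp: \<theta>_def field_simps)
    then show ?thesis
      using Riesz_Thorin[of "1/2" 0 \<theta> A] that by (simp add: opp op2 opinf \<theta>_def)
  qed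
qed

end
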